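(* The set $$SI=\{x\in\mathbb{N}\mid \text{there exists a total recursive } F:\mathbb{N}\to\mathbb{N} \text{ such that } \forall z\in\mathbb{N},\ \varphi_x(z)\downarrow\implies F(z)\geq\varphi_x(z)\}$$ belongs to $\Sigma^0_3$ in the arithmetical hierarchy.
   Context: Fix an acceptable Gödel numbering of the partial recursive functions: $\varphi_x$ denotes the partial recursive function $\mathbb{N}\to\mathbb{N}$ with Gödel number $x$; $\varphi_x(z)\downarrow$ means $\varphi_x$ is defined on $z$. *)

theory Defs
  imports Main
begin

definition minimise :: "(nat \<Rightarrow> nat option) \<Rightarrow> nat option" where
  "minimise h =
     (if \<exists>k. h k = Some 0 \<and> (\<forall>j<k. \<exists>v>0. h j = Some v)
      then Some (LEAST k. h k = Some 0) else None)"

text \<open>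
  An \<open>n\<close>-ary partial function is a map on lists of which only the values on lists of length
  \<open>n\<close> matter; rule \<open>cong\<close> makes the class insensitive to the other values.
  Composition is strict: it is undefined as soon as one of the inner values is.
\<close>

inductive partial_recursive :: "nat \<Rightarrow> (nat list \<Rightarrow> nat option) \<Rightarrow> bool" where
  zero: "partial_recursive n (\<lambda>xs. Some 0)"
| succ: "partial_recursive 1 (\<lambda>xs. Some (Suc (xs ! 0)))"
| proj: "i < n \<Longrightarrow> partial_recursive n (\<lambda>xs. Some (xs ! i))"
| comp: "partial_recursive (length gs) f \<Longrightarrow> (\<forall>g\<in>set gs. partial_recursive n g) \<Longrightarrow>
    partial_recursive n (\<lambda>xs. Option.bind (those (map (\<lambda>g. g xs) gs)) f)"
| prim_rec: "partial_recursive n f \<Longrightarrow> partial_recursive (n + 2) g \<Longrightarrow>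
    partial_recursive (Suc n)
      (\<lambda>xs. rec_nat (f (tl xs)) (\<lambda>k r. Option.bind r (\<lambda>v. g (k # v # tl xs))) (hd xs))"
| minim: "partial_recursive (Suc n) f \<Longrightarrow>
    partial_recursive n (\<lambda>xs. minimise (\<lambda>k. f (k # xs)))"
| cong: "partial_recursive n f \<Longrightarrow> (\<forall>xs. length xs = n \<longrightarrow> g xs = f xs) \<Longrightarrow>
    partial_recursive n g"

definition partial_recursive1 :: "(nat \<Rightarrow> nat option) \<Rightarrow> bool" where
  "partial_recursive1 f \<longleftrightarrow> partial_recursive 1 (\<lambda>xs. f (xs ! 0))"

definition partial_recursive2 :: "(nat \<Rightarrow> nat \<Rightarrow> nat option) \<Rightarrow> bool" where
  "partial_recursive2 f \<longleftrightarrow> partial_recursive 2 (\<lambda>xs. f (xs ! 0) (xs ! 1))"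

definition total_recursive1 :: "(nat \<Rightarrow> nat) \<Rightarrow> bool" where
  "total_recursive1 F \<longleftrightarrow> partial_recursive1 (\<lambda>x. Some (F x))"

text \<open>
  A numbering of exactly the unary partial recursive functions is acceptable if its universal
  function is partial recursive (enumeration theorem) and every partial recursive family of
  unary functions is computably translated into it (parametrisation, or s-m-n, theorem).
\<close>

definition acceptable_numbering :: "(nat \<Rightarrow> nat \<Rightarrow> nat option) \<Rightarrow> bool" where
  "acceptable_numbering \<phi> \<longleftrightarrow>
     range \<phi> = {f. partial_recursive1 f} \<and>
     partial_recursive2 \<phi> \<and>
     (\<forall>\<psi>. partial_recursive2 \<psi> \<longrightarrow> (\<exists>s. total_recursive1 s \<and> (\<forall>x. \<phi> (s x) = \<psi> x)))"

definition recursive_relation :: "nat \<Rightarrow> (nat list \<Rightarrow> bool) \<Rightarrow> bool" where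
  "recursive_relation k R \<longleftrightarrow> partial_recursive k (\<lambda>xs. Some (if R xs then 1 else 0))"

text \<open>
  The \<open>k\<close>-ary relations \<open>\<exists>y\<^sub>1. \<forall>y\<^sub>2. \<dots> R(y\<^sub>n, \<dots>, y\<^sub>1, x\<^sub>1, \<dots>, x\<^sub>k)\<close>, respectively
  \<open>\<forall>y\<^sub>1. \<exists>y\<^sub>2. \<dots> R(y\<^sub>n, \<dots>, y\<^sub>1, x\<^sub>1, \<dots>, x\<^sub>k)\<close>, with \<open>n\<close> alternating number quantifiers and
  recursive \<open>R\<close>.
\<close>

fun sigma_relation :: "nat \<Rightarrow> nat \<Rightarrow> (nat list \<Rightarrow> bool) \<Rightarrow> bool"
  and pi_relation :: "nat \<Rightarrow> nat \<Rightarrow> (nat list \<Rightarrow> bool) \<Rightarrow> bool" where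
  "sigma_relation 0 k A \<longleftrightarrow> recursive_relation k A"
| "sigma_relation (Suc n) k A \<longleftrightarrow>
     (\<exists>P. pi_relation n (Suc k) P \<and> (\<forall>xs. length xs = k \<longrightarrow> (A xs \<longleftrightarrow> (\<exists>y. P (y # xs)))))"
| "pi_relation 0 k A \<longleftrightarrow> recursive_relation k A"
| "pi_relation (Suc n) k A \<longleftrightarrow>
     (\<exists>P. sigma_relation n (Suc k) P \<and> (\<forall>xs. length xs = k \<longrightarrow> (A xs \<longleftrightarrow> (\<forall>y. P (y # xs)))))"

definition Sigma0 :: "nat \<Rightarrow> nat set set" where
  "Sigma0 n = {A. sigma_relation n 1 (\<lambda>xs. xs ! 0 \<in> A)}"

definition SI :: "(nat \<Rightarrow> nat \<Rightarrow> nat option) \<Rightarrow> nat set" where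
  "SI \<phi> = {x. \<exists>F. total_recursive1 F \<and> (\<forall>z. \<forall>y. \<phi> x z = Some y \<longrightarrow> F z \<ge> y)}"

end

theory Submission
  imports Defs
begin

text \<open>
  Every partial recursive function has a recursive stage function that is monotone in the stage;
  let \<open>S\<close> be one for the universal function \<open>\<phi>\<close>, with \<open>S [t, e, z] = 0\<close> for ``no value by stage
  \<open>t\<close>'' and \<open>S [t, e, z] = Suc y\<close> for ``value \<open>y\<close>''.  Then \<open>x \<in> SI \<phi>\<close> iff some index \<open>e\<close> of a
  total function bounds \<open>\<phi> x\<close>, that is, iff
  \<open>\<exists>e. \<forall>p. \<exists>u. \<forall>z<p. S [u, e, z] \<noteq> 0 \<and> S [p, x, z] \<le> S [u, e, z]\<close>.
  Letting \<open>p\<close> bound both the argument and the stage avoids pairing functions.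
\<close>

section \<open>Closure properties of recursive functions\<close>

definition recursive_fun :: "nat \<Rightarrow> (nat list \<Rightarrow> nat) \<Rightarrow> bool" where
  "recursive_fun n F \<longleftrightarrow> partial_recursive n (\<lambda>xs. Some (F xs))"

lemma recursive_fun_cong:
  assumes "recursive_fun n F" "\<And>xs. length xs = n \<Longrightarrow> G xs = F xs"
  shows "recursive_fun n G"
  using assms(1) unfolding recursive_fun_def
  by (rule partial_recursive.cong) (simp add: assms(2))

lemma recursive_fun_nth: "i < n \<Longrightarrow> recursive_fun n (\<lambda>xs. xs ! i)"
  unfolding recursive_fun_def by (rule partial_recursive.proj)

lemma those_map_Some: "those (map (\<lambda>x. Some (f x)) xs) = Some (map f xs)"
  by (induction xs) auto

lemma recursive_fun_comp:
  assumes "recursive_fun (length Gs) F" "\<And>G. G \<in> set Gs \<Longrightarrow> recursive_fun n G"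
  shows "recursive_fun n (\<lambda>xs. F (map (\<lambda>G. G xs) Gs))"
proof -
  have "partial_recursive n (\<lambda>xs. Option.bind
          (those (map (\<lambda>g. g xs) (map (\<lambda>G xs. Some (G xs)) Gs))) (\<lambda>ys. Some (F ys)))"
    using assms unfolding recursive_fun_def by (intro partial_recursive.comp) auto
  then show ?thesis
    by (simp add: recursive_fun_def comp_def those_map_Some)
qed

text \<open>The arguments from position \<open>j\<close> on are passed through by projections. Later
  substitutions therefore only list the entries that they change.\<close>

lemma recursive_fun_comp_drop:
  assumes "recursive_fun (length Gs + (n - j)) F" "\<And>G. G \<in> set Gs \<Longrightarrow> recursive_fun n G"
  shows "recursive_fun n (\<lambda>xs. F (map (\<lambda>G. G xs) Gs @ drop j xs))"
proof -
  let ?Hs = "Gs @ map (\<lambda>i xs. xs ! i) [j..<n]"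
  have "recursive_fun n (\<lambda>xs. F (map (\<lambda>G. G xs) ?Hs))"
    using assms by (intro recursive_fun_comp) (auto intro: recursive_fun_nth)
  then show ?thesis
  proof (rule recursive_fun_cong)
    fix xs :: "nat list" assume "length xs = n"
    then have "map (\<lambda>i. xs ! i) [j..<n] = drop j xs"
      by (intro nth_equalityI) auto
    then show "F (map (\<lambda>G. G xs) Gs @ drop j xs) = F (map (\<lambda>G. G xs) ?Hs)"
      by (simp add: comp_def)
  qed
qed

lemma recursive_fun_comp1:
  assumes "recursive_fun 1 (\<lambda>xs. f (xs ! 0))" "recursive_fun n A"
  shows "recursive_fun n (\<lambda>xs. f (A xs))"
  using recursive_fun_comp[of "[A]" "\<lambda>xs. f (xs ! 0)" n] assms by simp

text \<open>With a total base and a total step function the strict recursion never meets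
  \<open>None\<close>, so it collapses to an ordinary \<open>rec_nat\<close>.\<close>

lemma recursive_fun_prim_rec:
  assumes "recursive_fun n F" "recursive_fun (n + 2) G"
  shows "recursive_fun (Suc n) (\<lambda>xs. rec_nat (F (tl xs)) (\<lambda>k r. G (k # r # tl xs)) (hd xs))"
proof -
  have "rec_nat (Some a) (\<lambda>k r. Option.bind r (\<lambda>v. Some (g k v))) m = Some (rec_nat a g m)"
    for a m :: nat and g
    by (induction m) auto
  then show ?thesis
    using partial_recursive.prim_rec[of n "\<lambda>xs. Some (F xs)" "\<lambda>xs. Some (G xs)"] assms
    by (simp add: recursive_fun_def)
qed

lemma recursive_fun_rec_nat:
  assumes "recursive_fun n A" "recursive_fun (n + 2) (\<lambda>xs. g (xs ! 0) (xs ! 1) (drop 2 xs))"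
    and "recursive_fun n M"
  \<comment> \<open>Putting \<open>M xs\<close> in front of the unchanged list makes it the
    recursion argument, and \<open>tl\<close> then returns all of \<open>xs\<close> as
    parameters.\<close>
  shows "recursive_fun n (\<lambda>xs. rec_nat (A xs) (\<lambda>k r. g k r xs) (M xs))"
  using recursive_fun_comp_drop[of "[M]" n 0, simplified,
      OF recursive_fun_prim_rec[OF assms(1,2)] assms(3)]
  by (simp add: numeral_2_eq_2)

lemma recursive_fun_Suc: "recursive_fun n A \<Longrightarrow> recursive_fun n (\<lambda>xs. Suc (A xs))"
  using recursive_fun_comp1[of Suc] partial_recursive.succ by (simp add: recursive_fun_def)

lemma recursive_fun_const: "recursive_fun n (\<lambda>xs. c)"
proof (induction c)
  case 0
  then show ?case
    unfolding recursive_fun_def by (rule partial_recursive.zero)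
qed (rule recursive_fun_Suc)

lemma recursive_fun_drop:
  assumes "recursive_fun n F"
  shows "recursive_fun (n + j) (\<lambda>xs. F (drop j xs))"
  using recursive_fun_comp_drop[of "[]" "n + j" j F] assms by simp

text \<open>Case distinction is a recursion on the condition whose step ignores both the counter and
  the previous value.\<close>

lemma recursive_fun_if_zero:
  assumes "recursive_fun n C" "recursive_fun n A" "recursive_fun n B"
  shows "recursive_fun n (\<lambda>xs. if C xs = 0 then A xs else B xs)"
proof -
  have "recursive_fun n (\<lambda>xs. rec_nat (A xs) (\<lambda>k r. B xs) (C xs))"
    using assms by (intro recursive_fun_rec_nat recursive_fun_drop)
  moreover have "rec_nat a (\<lambda>k r. b) c = (if c = 0 then a else b)" for a b c :: nat
    by (cases c) auto
  ultimately show ?thesis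
    by simp
qed

text \<open>Truncated subtraction iterates the predecessor, which is itself the recursion that
  returns its counter.\<close>

lemma recursive_fun_diff:
  assumes "recursive_fun n A" "recursive_fun n B"
  shows "recursive_fun n (\<lambda>xs. A xs - B xs)"
proof -
  have "rec_nat 0 (\<lambda>k r. k) a = a - 1" for a :: nat
    by (cases a) auto
  then have pred: "recursive_fun 1 (\<lambda>xs. xs ! 0 - 1)"
    using recursive_fun_rec_nat[of 1 "\<lambda>xs. 0" "\<lambda>k r xs. k" "\<lambda>xs. xs ! 0"]
    by (simp add: recursive_fun_const recursive_fun_nth)
  have "recursive_fun n (\<lambda>xs. rec_nat (A xs) (\<lambda>k r. r - 1) (B xs))"
    using recursive_fun_comp1[OF pred recursive_fun_nth[of 1 "n + 2"]]
    by (intro recursive_fun_rec_nat assms) simp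
  moreover have "rec_nat a (\<lambda>k r. r - 1) b = a - b" for a b :: nat
    by (induction b) auto
  ultimately show ?thesis
    by simp
qed

section \<open>Stage functions\<close>

text \<open>In the flat order on \<open>'a option\<close>, with \<open>None\<close> at the bottom,
  \<open>h\<close> is an increasing chain and \<open>v\<close> is its supremum.\<close>

definition stagewise :: "(nat \<Rightarrow> 'a option) \<Rightarrow> 'a option \<Rightarrow> bool" where
  "stagewise h v \<longleftrightarrow>
     (\<forall>t t' y. t \<le> t' \<longrightarrow> h t = Some y \<longrightarrow> h t' = Some y) \<and>
     (\<forall>y. v = Some y \<longleftrightarrow> (\<exists>t. h t = Some y))"

lemma stagewise_mono: "stagewise h v \<Longrightarrow> h t = Some y \<Longrightarrow> t \<le> t' \<Longrightarrow> h t' = Some y"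
  unfolding stagewise_def by blast

lemma stagewise_Some_iff: "stagewise h v \<Longrightarrow> v = Some y \<longleftrightarrow> (\<exists>t. h t = Some y)"
  unfolding stagewise_def by blast

lemma stagewise_const: "stagewise (\<lambda>t. v) v"
  unfolding stagewise_def by blast

text \<open>Strict composition is continuous in the argument and in the function. The stages at
  which the two values appear are merged by their maximum, since values persist.\<close>

lemma stagewise_bind:
  assumes h: "stagewise h v" and w: "\<And>y. stagewise (\<lambda>t. H t y) (w y)"
  shows "stagewise (\<lambda>t. Option.bind (h t) (H t)) (Option.bind v w)"
proof -
  have "Option.bind (h t') (H t') = Some z" if "t \<le> t'" "Option.bind (h t) (H t) = Some z" for t t' z
    using that stagewise_mono[OF h] stagewise_mono[OF w] unfolding bind_eq_Some_conv by blast
  moreover have "Option.bind v w = Some z \<longleftrightarrow> (\<exists>t. Option.bind (h t) (H t) = Some z)" for z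
  proof
    assume "Option.bind v w = Some z"
    then obtain y where "v = Some y" "w y = Some z"
      by (auto simp: bind_eq_Some_conv)
    then obtain t t' where "h t = Some y" "H t' y = Some z"
      using stagewise_Some_iff[OF h] stagewise_Some_iff[OF w] by blast
    then have "h (max t t') = Some y" "H (max t t') y = Some z"
      using stagewise_mono[OF h] stagewise_mono[OF w] by (meson max.cobounded1 max.cobounded2)+
    then show "\<exists>t. Option.bind (h t) (H t) = Some z"
      by (auto simp: bind_eq_Some_conv)
  next
    assume "\<exists>t. Option.bind (h t) (H t) = Some z"
    then show "Option.bind v w = Some z"
      using stagewise_Some_iff[OF h] stagewise_Some_iff[OF w] unfolding bind_eq_Some_conv by blast
  qed
  ultimately show ?thesis
    unfolding stagewise_def by blast
qed

lemma stagewise_those: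
  assumes "\<And>g. g \<in> set gs \<Longrightarrow> stagewise (h g) (v g)"
  shows "stagewise (\<lambda>t. those (map (\<lambda>g. h g t) gs)) (those (map v gs))"
  using assms
proof (induction gs)
  case Nil
  show ?case
    by (simp add: stagewise_const)
next
  case (Cons g gs)
  \<comment> \<open>As nested binds, \<open>those\<close> falls under
    \<open>stagewise_bind\<close>.\<close>
  have those_Cons: "those (x # xs) = Option.bind x (\<lambda>a. Option.bind (those xs) (\<lambda>as. Some (a # as)))"
    for x :: "'b option" and xs
    by (cases x; cases "those xs") auto
  show ?case
    unfolding list.map those_Cons using Cons
    by (intro stagewise_bind stagewise_const) auto
qed

text \<open>Finitely many stages have a maximum, and values persist beyond it. This serves the
  arguments up to the result of a minimisation, and later the bounded quantifier over
  \<open>z\<close>.\<close>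

lemma stagewise_common_stage:
  assumes "finite J" "\<And>j. j \<in> J \<Longrightarrow> stagewise (\<lambda>t. h t j) (w j)" "\<And>j. j \<in> J \<Longrightarrow> w j \<noteq> None"
  shows "\<exists>t. \<forall>t'\<ge>t. \<forall>j\<in>J. h t' j = w j"
  using assms
proof (induction J)
  case (insert i J)
  have w: "stagewise (\<lambda>t. h t i) (w i)" "w i \<noteq> None"
    using insert.prems by simp_all
  have "\<exists>t. \<forall>t'\<ge>t. \<forall>j\<in>J. h t' j = w j"
    using insert.prems by (intro insert.IH) simp_all
  then obtain t where t: "\<forall>t'\<ge>t. \<forall>j\<in>J. h t' j = w j"
    by blast
  from w(2) obtain y where y: "w i = Some y"
    by blast
  then obtain s where "h s i = Some y"
    using stagewise_Some_iff[OF w(1)] by blast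
  then have "\<forall>t'\<ge>s. h t' i = Some y"
    using stagewise_mono[OF w(1)] by blast
  with t y have "\<forall>t'\<ge>max s t. \<forall>j\<in>insert i J. h t' j = w j"
    by simp
  then show ?case
    by blast
qed simp

section \<open>Minimisation by stages\<close>

lemma minimise_eq_Some_iff:
  "minimise h = Some k \<longleftrightarrow> h k = Some 0 \<and> (\<forall>j<k. \<exists>v>0. h j = Some v)"
proof -
  have *: "(LEAST k. h k = Some 0) = k" if "h k = Some 0" "\<forall>j<k. \<exists>v>0. h j = Some v" for k
    using that by (intro Least_equality) (auto simp: not_less[symmetric])
  then show ?thesis
    unfolding minimise_def by auto
qed

text \<open>The cut-off at \<open>n\<close> leaves only finitely many candidates, so that a
  recursion of length \<open>n\<close> can compute the result.\<close>

definition bounded_minimise :: "nat \<Rightarrow> (nat \<Rightarrow> nat option) \<Rightarrow> nat option" where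
  "bounded_minimise n h =
     Option.bind (minimise h) (\<lambda>k. if k < n then Some k else None)"

lemma bounded_minimise_eq_Some_iff:
  "bounded_minimise n h = Some k \<longleftrightarrow> k < n \<and> h k = Some 0 \<and> (\<forall>j<k. \<exists>v>0. h j = Some v)"
  by (auto simp: bounded_minimise_def bind_eq_Some_conv minimise_eq_Some_iff split: if_splits)

text \<open>The stage has two roles: it is the stage at which the values are evaluated and the bound
  on the search.\<close>

lemma stagewise_minimise:
  assumes "\<And>k. stagewise (\<lambda>t. h t k) (w k)"
  shows "stagewise (\<lambda>t. bounded_minimise t (h t)) (minimise w)"
proof -
  note mono = stagewise_mono[OF assms]
  have "bounded_minimise t' (h t') = Some k"
    if "t \<le> t'" "bounded_minimise t (h t) = Some k" for t t' k
    using that mono unfolding bounded_minimise_eq_Some_iff by (meson order_less_le_trans)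
  moreover have "minimise w = Some k \<longleftrightarrow> (\<exists>t. bounded_minimise t (h t) = Some k)" for k
  proof
    assume "minimise w = Some k"
    then have w: "w k = Some 0" "\<And>j. j < k \<Longrightarrow> \<exists>v>0. w j = Some v"
      by (auto simp: minimise_eq_Some_iff)
    have "w j \<noteq> None" if "j \<in> {..k}" for j
      using w(1) w(2)[of j] that by (cases "j < k") auto
    then obtain t where "\<forall>t'\<ge>t. \<forall>j\<in>{..k}. h t' j = w j"
      using stagewise_common_stage[of "{..k}" h w] assms by auto
    \<comment> \<open>The stage must be late enough for all values up to \<open>k\<close> and also
      exceed \<open>k\<close>, because the cut-off is strict.\<close>
    then have "\<forall>j\<in>{..k}. h (max t (Suc k)) j = w j"
      by (meson max.cobounded1)
    then have "bounded_minimise (max t (Suc k)) (h (max t (Suc k))) = Some k"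
      using w by (auto simp: bounded_minimise_eq_Some_iff)
    then show "\<exists>t. bounded_minimise t (h t) = Some k"
      by blast
  next
    assume "\<exists>t. bounded_minimise t (h t) = Some k"
    then show "minimise w = Some k"
      unfolding bounded_minimise_eq_Some_iff minimise_eq_Some_iff
      using stagewise_Some_iff[OF assms] by blast
  qed
  ultimately show ?thesis
    unfolding stagewise_def by blast
qed

section \<open>Coding partial values by numbers\<close>

definition decode_option :: "nat \<Rightarrow> nat option" where
  "decode_option c = (if c = 0 then None else Some (c - 1))"

lemma decode_option_simps [simp]:
  "decode_option 0 = None" "decode_option (Suc y) = Some y"
  "decode_option c = Some y \<longleftrightarrow> c = Suc y" "decode_option c = None \<longleftrightarrow> c = 0"
  by (auto simp: decode_option_def)

lemma those_map_decode_option: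
  "those (map (\<lambda>g. decode_option (c g)) gs) =
     (if \<forall>g\<in>set gs. c g \<noteq> 0 then Some (map (\<lambda>g. c g - 1) gs) else None)"
  by (induction gs) (auto simp: decode_option_def)

text \<open>State \<open>0\<close>: still searching; \<open>1\<close>: an undefined value was met; \<open>k + 2\<close>: the search found \<open>k\<close>.\<close>

definition search :: "(nat \<Rightarrow> nat) \<Rightarrow> nat \<Rightarrow> nat" where
  "search c =
     rec_nat 0 (\<lambda>k r. if r = 0 then if c k = 0 then 1 else if c k - 1 = 0 then Suc (Suc k) else 0 else r)"

text \<open>Subtracting \<open>1\<close> sends the states \<open>0\<close> and \<open>1\<close> to
  the code of \<open>None\<close> and the state \<open>k + 2\<close> to \<open>Suc k\<close>, the
  code of \<open>k\<close>.\<close>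

lemma bounded_minimise_decode_option:
  "bounded_minimise n (\<lambda>k. decode_option (c k)) = decode_option (search c n - 1)"
proof -
  \<comment> \<open>The invariant describes the states \<open>0\<close> and \<open>k + 2\<close>;
    the failure state \<open>1\<close> is what remains. A code of at least \<open>2\<close> stands
    for a defined positive value.\<close>
  have "(search c n = 0 \<longleftrightarrow> (\<forall>j<n. c j \<ge> 2)) \<and>
        (\<forall>k. search c n = Suc (Suc k) \<longleftrightarrow> k < n \<and> c k = 1 \<and> (\<forall>j<k. c j \<ge> 2))"
  proof (induction n)
    case 0
    show ?case
      by (simp add: search_def)
  next
    case (Suc n)
    have step: "search c (Suc n) =
        (if search c n = 0 then if c n = 0 then 1 else if c n - 1 = 0 then Suc (Suc n) else 0
         else search c n)"
      by (simp add: search_def)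
    show ?case
    proof (cases "search c n = 0")
      case True
      with Suc have all: "\<forall>j<n. c j \<ge> 2"
        by simp
      consider "c n = 0" | "c n = 1" | "c n \<ge> 2"
        by linarith
      then show ?thesis
      proof cases
        case 1
        with True all show ?thesis by (auto simp: step less_Suc_eq)
      next
        case 2
        with True all show ?thesis by (auto simp: step less_Suc_eq)
      next
        case 3
        with True all show ?thesis by (auto simp: step less_Suc_eq)
      qed
    next
      case False
      \<comment> \<open>This \<open>i\<close> has already ended the search, so \<open>n\<close>
        cannot become its result.\<close>
      with Suc obtain i where "i < n" "\<not> c i \<ge> 2"
        by blast
      with False Suc show ?thesis
        by (auto simp: step less_Suc_eq)
    qed
  qed
  moreover have "(\<exists>v>0. decode_option a = Some v) \<longleftrightarrow> a \<ge> 2" for a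
    by (auto simp: decode_option_def)
  ultimately have "bounded_minimise n (\<lambda>k. decode_option (c k)) = Some k \<longleftrightarrow>
      decode_option (search c n - 1) = Some k" for k
    by (cases "search c n") (auto simp: bounded_minimise_eq_Some_iff)
  then show ?thesis
    by (metis not_Some_eq)
qed

section \<open>Recursive stage functions for the formation rules\<close>

definition stage_fun :: "nat \<Rightarrow> (nat list \<Rightarrow> nat option) \<Rightarrow> (nat list \<Rightarrow> nat) \<Rightarrow> bool" where
  "stage_fun n f S \<longleftrightarrow> recursive_fun (Suc n) S \<and>
     (\<forall>xs. length xs = n \<longrightarrow> stagewise (\<lambda>t. decode_option (S (t # xs))) (f xs))"

text \<open>A total function has its value at every stage; \<open>drop 1\<close> discards the stage
  argument.\<close>

lemma stage_fun_total:
  assumes "recursive_fun n F"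
  shows "stage_fun n (\<lambda>xs. Some (F xs)) (\<lambda>ys. Suc (F (drop 1 ys)))"
  using recursive_fun_Suc[OF recursive_fun_drop[OF assms, of 1]]
  by (simp add: stage_fun_def stagewise_const)

text \<open>Inner and outer functions are run at the same stage, and a missing inner value gives the
  code \<open>0\<close>. The test is written as a number compared with \<open>0\<close> to fit
  \<open>recursive_fun_if_zero\<close>.\<close>

lemma stage_fun_comp:
  assumes f: "stage_fun (length gs) f Sf"
    and g: "\<And>g. g \<in> set gs \<Longrightarrow> stage_fun n g (T g)"
  shows "stage_fun n (\<lambda>xs. Option.bind (those (map (\<lambda>g. g xs) gs)) f)
           (\<lambda>ys. if (if \<forall>g\<in>set gs. T g ys \<noteq> 0 then 1 else 0 :: nat) = 0 then 0
                 else Sf (hd ys # map (\<lambda>g. T g ys - 1) gs))"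
    (is "stage_fun n _ ?S")
proof -
  have T: "recursive_fun (Suc n) (T g)" if "g \<in> set gs" for g
    using g[OF that] by (simp add: stage_fun_def)
  then have "recursive_fun (Suc n) (\<lambda>ys. if \<forall>g\<in>set gs. T g ys \<noteq> 0 then 1 else 0)"
  proof (induction gs)
    case (Cons g gs)
    then have "recursive_fun (Suc n)
        (\<lambda>ys. if T g ys = 0 then 0 else if \<forall>g\<in>set gs. T g ys \<noteq> 0 then 1 else 0)"
      by (intro recursive_fun_if_zero recursive_fun_const) auto
    then show ?case
      by (rule recursive_fun_cong) auto
  qed (simp add: recursive_fun_const)
  moreover
  let ?Gs = "(\<lambda>ys. ys ! 0) # map (\<lambda>g ys. T g ys - 1) gs"
  have "recursive_fun (Suc n) G" if "G \<in> set ?Gs" for G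
    using that T by (auto intro!: recursive_fun_nth recursive_fun_diff[of _ _ "\<lambda>_. Suc 0"] recursive_fun_const)
  then have "recursive_fun (Suc n) (\<lambda>ys. Sf (map (\<lambda>G. G ys) ?Gs))"
    using f by (intro recursive_fun_comp) (simp_all add: stage_fun_def)
  then have "recursive_fun (Suc n) (\<lambda>ys. Sf (hd ys # map (\<lambda>g. T g ys - 1) gs))"
    by (rule recursive_fun_cong) (auto simp: length_Suc_conv comp_def)
  ultimately have "recursive_fun (Suc n) ?S"
    by (intro recursive_fun_if_zero recursive_fun_const)
  moreover have "stagewise (\<lambda>t. decode_option (?S (t # xs)))
      (Option.bind (those (map (\<lambda>g. g xs) gs)) f)" if "length xs = n" for xs
  proof -
    \<comment> \<open>Nothing is known about \<open>Sf\<close> on lists of the wrong length, but \<open>stagewise_bind\<close> quantifies over all lists.\<close>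
    have f': "stagewise (\<lambda>t. if length zs = length gs then decode_option (Sf (t # zs)) else None)
        (if length zs = length gs then f zs else None)" for zs
      using f by (auto simp: stage_fun_def stagewise_const)
    have "stagewise
        (\<lambda>t. Option.bind (those (map (\<lambda>g. decode_option (T g (t # xs))) gs))
          (\<lambda>zs. if length zs = length gs then decode_option (Sf (t # zs)) else None))
        (Option.bind (those (map (\<lambda>g. g xs) gs)) (\<lambda>zs. if length zs = length gs then f zs else None))"
      using g that by (intro stagewise_bind stagewise_those f') (auto simp: stage_fun_def)
    \<comment> \<open>Since \<open>those\<close> preserves length, the guard always holds here and
      can be removed.\<close>
    moreover have "length zs = length hs" if "those hs = Some zs" for hs :: "nat option list" and zs
      using that by (induction hs arbitrary: zs) (auto split: option.splits)
    then have "Option.bind (those hs) (\<lambda>zs. if length zs = length hs then f zs else None) =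
        Option.bind (those hs) f" for hs :: "nat option list"
      by (cases "those hs") auto
    from this[of "map (\<lambda>g. g xs) gs"]
    have "Option.bind (those (map (\<lambda>g. g xs) gs)) (\<lambda>zs. if length zs = length gs then f zs else None) =
        Option.bind (those (map (\<lambda>g. g xs) gs)) f"
      by simp
    moreover have "Option.bind (those (map (\<lambda>g. decode_option (T g (t # xs))) gs))
          (\<lambda>zs. if length zs = length gs then decode_option (Sf (t # zs)) else None) =
        decode_option (?S (t # xs))" for t
      unfolding those_map_decode_option by auto
    ultimately show ?thesis
      by simp
  qed
  ultimately show ?thesis
    by (simp add: stage_fun_def)
qed

text \<open>All calls in the recursion are run at the same stage. For a fixed recursion argument the
  value is an iterated bind, so induction on that argument with \<open>stagewise_bind\<close>
  applies.\<close>

lemma stage_fun_prim_rec: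
  assumes f: "stage_fun n f Sf" and g: "stage_fun (n + 2) g Sg"
  shows "stage_fun (Suc n)
           (\<lambda>xs. rec_nat (f (tl xs)) (\<lambda>k r. Option.bind r (\<lambda>v. g (k # v # tl xs))) (hd xs))
           (\<lambda>ys. rec_nat (Sf (ys ! 0 # drop 2 ys))
              (\<lambda>k r. if r = 0 then 0 else Sg (ys ! 0 # k # (r - 1) # drop 2 ys)) (ys ! 1))"
    (is "stage_fun _ ?f ?S")
proof -
  have "recursive_fun (Suc (Suc n)) (\<lambda>ys. Sf (ys ! 0 # drop 2 ys))"
    using recursive_fun_comp_drop[of "[\<lambda>ys. ys ! 0]" "Suc (Suc n)" 2 Sf] f
    by (simp add: stage_fun_def recursive_fun_nth)
  moreover
  \<comment> \<open>The list \<open>zs\<close> holds the counter, the coded accumulator, the stage,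
    the recursion argument, and then the parameters. The subtraction decodes the
    accumulator.\<close>
  let ?Gs = "[\<lambda>zs. zs ! 2, \<lambda>zs. zs ! 0, \<lambda>zs. zs ! 1 - 1] :: (nat list \<Rightarrow> nat) list"
  have "recursive_fun (Suc (Suc n) + 2) G" if "G \<in> set ?Gs" for G
    using that
    by (auto intro!: recursive_fun_nth recursive_fun_diff[of _ _ "\<lambda>_. Suc 0"] recursive_fun_const)
  then have "recursive_fun (Suc (Suc n) + 2) (\<lambda>zs. Sg (map (\<lambda>G. G zs) ?Gs @ drop 4 zs))"
    using g by (intro recursive_fun_comp_drop) (simp_all add: stage_fun_def)
  then have "recursive_fun (Suc (Suc n) + 2)
      (\<lambda>zs. Sg (drop 2 zs ! 0 # zs ! 0 # (zs ! 1 - 1) # drop 2 (drop 2 zs)))"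
    by (rule recursive_fun_cong) (auto simp: numeral_eq_Suc)
  ultimately have "recursive_fun (Suc (Suc n)) ?S"
    by (intro recursive_fun_rec_nat recursive_fun_if_zero recursive_fun_const recursive_fun_nth) auto
  moreover have "stagewise (\<lambda>t. decode_option (?S (t # xs))) (?f xs)" if "length xs = Suc n" for xs
  proof -
    from that obtain m as where xs: "xs = m # as" "length as = n"
      by (auto simp: length_Suc_conv)
    have bind: "Option.bind (decode_option r) (\<lambda>v. decode_option (h v)) =
        decode_option (if r = 0 then 0 else h (r - 1))" for r h
      by (auto simp: decode_option_def)
    have "stagewise
        (\<lambda>t. decode_option (rec_nat (Sf (t # as)) (\<lambda>k r. if r = 0 then 0 else Sg (t # k # (r - 1) # as)) m))
        (rec_nat (f as) (\<lambda>k r. Option.bind r (\<lambda>v. g (k # v # as))) m)"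
    proof (induction m)
      case 0
      then show ?case
        using f xs by (simp add: stage_fun_def)
    next
      case (Suc m)
      have "stagewise (\<lambda>t. decode_option (Sg (t # m # v # as))) (g (m # v # as))" for v
        using g xs by (simp add: stage_fun_def)
      from stagewise_bind[OF Suc this] show ?case
        by (simp only: bind nat.rec)
    qed
    then show ?thesis
      by (simp add: xs cong: if_cong)
  qed
  ultimately show ?thesis
    by (simp add: stage_fun_def)
qed

lemma stage_fun_minimise:
  assumes f: "stage_fun (Suc n) f S"
  shows "stage_fun n (\<lambda>xs. minimise (\<lambda>k. f (k # xs)))
           (\<lambda>ys. search (\<lambda>k. S (ys ! 0 # k # drop 1 ys)) (ys ! 0) - 1)"
    (is "stage_fun _ ?f ?S")
proof -
  have "recursive_fun (Suc n + 2) (\<lambda>zs. S (zs ! 2 # zs ! 0 # drop 3 zs))"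
    using recursive_fun_comp_drop[of "[\<lambda>zs. zs ! 2, \<lambda>zs. zs ! 0]" "Suc n + 2" 3 S] f
    by (auto simp: stage_fun_def numeral_eq_Suc intro!: recursive_fun_nth)
  then have "recursive_fun (Suc n + 2) (\<lambda>zs. S (drop 2 zs ! 0 # zs ! 0 # drop 1 (drop 2 zs)))"
    by (rule recursive_fun_cong) (auto simp: numeral_eq_Suc)
  then have "recursive_fun (Suc n) ?S"
    unfolding search_def
    by (intro recursive_fun_rec_nat recursive_fun_if_zero recursive_fun_const recursive_fun_nth
        recursive_fun_diff recursive_fun_Suc) auto
  moreover have "stagewise (\<lambda>t. decode_option (?S (t # xs))) (?f xs)" if "length xs = n" for xs
  proof -
    have "stagewise (\<lambda>t. decode_option (S (t # k # xs))) (f (k # xs))" for k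
      using f that by (simp add: stage_fun_def)
    from stagewise_minimise[OF this] show ?thesis
      by (simp add: bounded_minimise_decode_option)
  qed
  ultimately show ?thesis
    by (simp add: stage_fun_def)
qed

text \<open>This takes the place of Kleene's normal form theorem. The stage function is built by
  induction on the formation rules, without coding computations.\<close>

theorem partial_recursive_stage_fun: "partial_recursive n f \<Longrightarrow> \<exists>S. stage_fun n f S"
proof (induction rule: partial_recursive.induct)
  case (zero n)
  show ?case
    using stage_fun_total recursive_fun_const by blast
next
  case succ
  have "recursive_fun 1 (\<lambda>xs. Suc (xs ! 0))"
    by (intro recursive_fun_Suc recursive_fun_nth) simp
  then show ?case
    using stage_fun_total by blast
next
  case (proj i n)
  then show ?case
    using stage_fun_total recursive_fun_nth by blast
next
  case (comp gs f n)
  then obtain Sf where "stage_fun (length gs) f Sf"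
    by blast
  moreover from comp have "\<forall>g\<in>set gs. \<exists>S. stage_fun n g S"
    by blast
  then obtain T where "\<forall>g\<in>set gs. stage_fun n g (T g)"
    by metis
  ultimately show ?case
    using stage_fun_comp by blast
next
  case (prim_rec n f g)
  then show ?case
    using stage_fun_prim_rec by blast
next
  case (minim n f)
  then show ?case
    using stage_fun_minimise by blast
next
  case (cong n f g)
  then show ?case
    by (auto simp: stage_fun_def)
qed

section \<open>The quantifier prefix\<close>

text \<open>The accumulator starts at \<open>1\<close> and drops to \<open>0\<close> for good at the
  first failing \<open>z\<close>. Thus a bounded quantifier adds nothing to the quantifier
  prefix.\<close>

lemma recursive_relation_bounded_all:
  assumes "recursive_fun (Suc n) C" "recursive_fun n M"
  shows "recursive_relation n (\<lambda>xs. \<forall>z < M xs. C (z # xs) = 0)"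
proof -
  have "recursive_fun (n + 2) (\<lambda>ys. C (ys ! 0 # drop 2 ys))"
    using recursive_fun_comp_drop[of "[\<lambda>ys. ys ! 0]" "n + 2" 2 C] assms(1)
    by (simp add: recursive_fun_nth)
  then have "recursive_fun n
      (\<lambda>xs. rec_nat 1 (\<lambda>z r. if C (z # xs) = 0 then r else 0) (M xs))"
    using assms(2)
    by (intro recursive_fun_rec_nat recursive_fun_if_zero recursive_fun_const recursive_fun_nth) auto
  moreover have "rec_nat 1 (\<lambda>z r. if P z then r else 0) m = (if \<forall>z<m. P z then 1 else 0 :: nat)"
    for P m
    by (induction m) (auto simp: less_Suc_eq)
  ultimately show ?thesis
    by (simp add: recursive_relation_def recursive_fun_def)
qed

text \<open>Forwards, \<open>e\<close> is an index of the bound \<open>F\<close>, and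
  \<open>u\<close> is a stage at which \<open>\<phi> e\<close> has shown its values on all
  \<open>z < p\<close>. Backwards, \<open>\<phi> e\<close> is itself the bound. Codes may be
  compared directly, since both are shifted by one.\<close>

lemma SI_iff_stages:
  assumes range: "range \<phi> = {f. partial_recursive1 f}"
    and stages: "\<And>e z. stagewise (\<lambda>t. decode_option (S t e z)) (\<phi> e z)"
  shows "x \<in> SI \<phi> \<longleftrightarrow> (\<exists>e. \<forall>p. \<exists>u. \<forall>z<p. S u e z \<noteq> 0 \<and> S p x z \<le> S u e z)"
proof
  have value_iff: "\<phi> e z = Some y \<longleftrightarrow> (\<exists>t. S t e z = Suc y)" for e z y
    using stagewise_Some_iff[OF stages] by simp
  show "\<exists>e. \<forall>p. \<exists>u. \<forall>z<p. S u e z \<noteq> 0 \<and> S p x z \<le> S u e z" if "x \<in> SI \<phi>"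
  proof -
    from that obtain F where F: "partial_recursive1 (\<lambda>z. Some (F z))"
      and bound: "\<And>z y. \<phi> x z = Some y \<Longrightarrow> y \<le> F z"
      by (auto simp: SI_def total_recursive1_def)
    from F range obtain e where e: "\<phi> e = (\<lambda>z. Some (F z))"
      by (metis (mono_tags) imageE mem_Collect_eq)
    have "\<exists>u. \<forall>z<p. S u e z \<noteq> 0 \<and> S p x z \<le> S u e z" for p
    proof -
      have "stagewise (\<lambda>t. decode_option (S t e z)) (Some (F z))" for z
        using stages[of e z] by (simp add: e)
      then obtain u where u: "\<And>z. z < p \<Longrightarrow> S u e z = Suc (F z)"
        using stagewise_common_stage[of "{..<p}" "\<lambda>t z. decode_option (S t e z)" "\<lambda>z. Some (F z)"]
        by auto
      \<comment> \<open>The code \<open>0\<close> is trivially below; any other code is the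
        successor of a value of \<open>\<phi> x z\<close>.\<close>
      moreover have "S p x z \<le> Suc (F z)" for z
        using bound value_iff by (cases "S p x z") auto
      ultimately show ?thesis
        by (intro exI[of _ u]) auto
    qed
    then show ?thesis
      by blast
  qed
  show "x \<in> SI \<phi>" if "\<exists>e. \<forall>p. \<exists>u. \<forall>z<p. S u e z \<noteq> 0 \<and> S p x z \<le> S u e z"
  proof -
    from that obtain e where e: "\<And>p. \<exists>u. \<forall>z<p. S u e z \<noteq> 0 \<and> S p x z \<le> S u e z"
      by blast
    \<comment> \<open>Totality of \<open>\<phi> e\<close>: the least \<open>p\<close> that covers
      the argument \<open>z\<close> is \<open>Suc z\<close>.\<close>
    have "\<exists>y. \<phi> e z = Some y" for z
      using e[of "Suc z"] value_iff by (metis lessI not0_implies_Suc)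
    then obtain F where F: "\<And>z. \<phi> e z = Some (F z)"
      by metis
    then have "\<phi> e = (\<lambda>z. Some (F z))"
      by auto
    with range have "total_recursive1 F"
      unfolding total_recursive1_def by (metis (mono_tags) mem_Collect_eq rangeI)
    moreover have "y \<le> F z" if "\<phi> x z = Some y" for z y
    proof -
      from that obtain t where "S t x z = Suc y"
        using value_iff by blast
      \<comment> \<open>This \<open>p\<close> is late enough for the value \<open>y\<close> to have
        appeared and large enough that \<open>z < p\<close>.\<close>
      then have y: "S (max t (Suc z)) x z = Suc y"
        using stagewise_mono[OF stages, of t x z y "max t (Suc z)"] by simp
      obtain u where "S u e z \<noteq> 0" "S (max t (Suc z)) x z \<le> S u e z"
        using e[of "max t (Suc z)"] by (meson lessI less_max_iff_disj)
      then obtain v where v: "S u e z = Suc v" "y \<le> v"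
        using y by (cases "S u e z") auto
      then have "v = F z"
        using value_iff F by (metis option.inject)
      with v show ?thesis
        by simp
    qed
    ultimately show ?thesis
      by (auto simp: SI_def)
  qed
qed

text \<open>The prefix is assembled from the inside. Each quantifier takes the head of the list, so
  the arguments of \<open>R\<close> are ordered from the innermost variable to the outermost, with
  \<open>x\<close> last.\<close>

lemma Sigma0_3I:
  assumes "recursive_relation 4 R" "\<And>x. x \<in> A \<longleftrightarrow> (\<exists>e. \<forall>p. \<exists>u. R [u, p, e, x])"
  shows "A \<in> Sigma0 3"
proof -
  have "sigma_relation 1 3 (\<lambda>xs. \<exists>u. R (u # xs))"
    using assms(1) by (auto simp: numeral_eq_Suc)
  then have "pi_relation 2 (Suc 1) (\<lambda>xs. \<forall>p. \<exists>u. R (u # p # xs))"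
    by (auto simp: numeral_eq_Suc)
  moreover have "xs ! 0 \<in> A \<longleftrightarrow> (\<exists>e. \<forall>p. \<exists>u. R (u # p # e # xs))" if "length xs = 1" for xs
    using that assms(2)[of "xs ! 0"] by (cases xs) simp_all
  ultimately have "sigma_relation (Suc 2) 1 (\<lambda>xs. xs ! 0 \<in> A)"
    unfolding sigma_relation.simps by blast
  then show ?thesis
    by (simp add: Sigma0_def)
qed

theorem theorem5:
  fixes \<phi> :: "nat \<Rightarrow> nat \<Rightarrow> nat option"
  assumes "acceptable_numbering \<phi>"
  shows "SI \<phi> \<in> Sigma0 3"
proof -
  have range: "range \<phi> = {f. partial_recursive1 f}"
    and "partial_recursive 2 (\<lambda>xs. \<phi> (xs ! 0) (xs ! 1))"
    using assms by (auto simp: acceptable_numbering_def partial_recursive2_def)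
  then obtain S where S: "stage_fun 2 (\<lambda>xs. \<phi> (xs ! 0) (xs ! 1)) S"
    using partial_recursive_stage_fun by blast
  then have "recursive_fun 3 S"
    by (simp add: stage_fun_def)
  then have S_nth: "recursive_fun 5 (\<lambda>ys. S [ys ! i, ys ! j, ys ! k])" if "i < 5" "j < 5" "k < 5" for i j k
    using recursive_fun_comp[of "[\<lambda>ys. ys ! i, \<lambda>ys. ys ! j, \<lambda>ys. ys ! k]" S 5] that
    by (auto simp: numeral_3_eq_3 intro: recursive_fun_nth)
  \<comment> \<open>Here \<open>ys\<close> is \<open>[z, u, p, e, x]\<close>. Truncated subtraction
    vanishes exactly when the inequality holds, and the value \<open>1\<close> rejects the case
    where \<open>\<phi> e\<close> has no value on \<open>z\<close> by stage
    \<open>u\<close>.\<close>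
  define C where "C ys = (if S [ys ! 1, ys ! 3, ys ! 0] = 0 then 1
      else S [ys ! 2, ys ! 4, ys ! 0] - S [ys ! 1, ys ! 3, ys ! 0])" for ys
  have "recursive_fun 5 C"
    unfolding C_def
    by (intro recursive_fun_if_zero recursive_fun_diff recursive_fun_const S_nth) auto
  \<comment> \<open>The list \<open>xs\<close> is \<open>[u, p, e, x]\<close>, so the bound
    \<open>xs ! 1\<close> is \<open>p\<close>.\<close>
  then have rel: "recursive_relation 4 (\<lambda>xs. \<forall>z < xs ! 1. C (z # xs) = 0)"
    by (intro recursive_relation_bounded_all recursive_fun_nth) auto
  have "stagewise (\<lambda>t. decode_option (S [t, e, z])) (\<phi> e z)" for e z
  proof -
    have "length [e, z] = 2"
      by simp
    with S show ?thesis
      unfolding stage_fun_def by fastforce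
  qed
  then have "x \<in> SI \<phi> \<longleftrightarrow>
      (\<exists>e. \<forall>p. \<exists>u. \<forall>z<p. S [u, e, z] \<noteq> 0 \<and> S [p, x, z] \<le> S [u, e, z])" for x
    by (intro SI_iff_stages[OF range, of "\<lambda>t e z. S [t, e, z]"])
  moreover have "C (z # [u, p, e, x]) = 0 \<longleftrightarrow> S [u, e, z] \<noteq> 0 \<and> S [p, x, z] \<le> S [u, e, z]"
    for z u p e x
    by (simp add: C_def numeral_eq_Suc)
  ultimately have "x \<in> SI \<phi> \<longleftrightarrow>
      (\<exists>e. \<forall>p. \<exists>u. \<forall>z < [u, p, e, x] ! 1. C (z # [u, p, e, x]) = 0)" for x
    by simp
  with rel show ?thesis
    by (rule Sigma0_3I)
qed

end
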